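(* Let $A\in\mathbb{R}^{n\times n}$, $B\in\mathbb{R}^{n\times m}$ with $(A,B)$ controllable and $B$ of full column rank, let $T>0$, let $G:[0,T]\to\mathbb{S}^n$ be continuous and $P_0(T)\in\mathbb{S}^n$. Consider the convex optimization problem over symmetric-matrix-valued continuous functions $Y(t)$ on $[0,T]$ and $Q,Y_T\in\mathbb{S}^n$: $$\min_{Y,Q,Y_T}\ \frac12\int_0^T\|B^TY(t)\|_F^2\,dt\quad\text{s.t.}\quad \dot Y(t)=-A^TY(t)-Y(t)A-Q-G(t),\ Y(T)=Y_T,\ Q\succeq 0,\ Y_T+P_0(T)\succeq 0 .$$ Then $(Y,Q,Y_T)$, with $Y_T=Y(T)$, is an optimal solution if and only if there exist differentiable symmetric-matrix-valued functions $\Lambda(t),\Omega(t)$ on $[0,T]$ such that $$\dot Y=-A^TY-YA-Q-G(t),$$ $$\dot\Lambda=-\tfrac12\left(BB^TY+Y^TBB^T\right)+\Lambda^TA^T+A\Lambda^T,\qquad \dot\Omega=\Lambda,$$ $$\Lambda(0)=0,\quad \Omega(0)=0,\quad Q\,\Omega(T)=0,\quad (Y_T+P_0(T))\Lambda(T)=0,$$ $$\Omega(T)\preceq 0,\quad Q\succeq 0,\quad \Lambda(T)\preceq 0,\quad Y_T+P_0(T)\succeq 0 .$$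
   Context: $\mathbb{S}^n$ is the space of real symmetric $n\times n$ matrices; $X\succeq 0$ ($X\preceq 0$) means positive (negative) semidefinite; $\|\cdot\|_F$ is the Frobenius norm. In the paper, $G(t)=\dot P_0+A^TP_0+P_0A-P_0BB^TP_0$ with $P_0(t)=-K^T(t)(K(t)B)^\dagger K(t)$ obtained from an observed feedback matrix $K(t)$; only the continuity and symmetry of $G$ and the symmetry of $P_0(T)$ matter for the statement. *)

theory Defs
  imports "HOL-Analysis.Analysis"
begin

definition symmetric_matrix :: "real^'n^'n \<Rightarrow> bool" where
  "symmetric_matrix M \<longleftrightarrow> transpose M = M"

definition pos_semidef :: "real^'n^'n \<Rightarrow> bool" where
  "pos_semidef M \<longleftrightarrow> symmetric_matrix M \<and> (\<forall>x. 0 \<le> x \<bullet> (M *v x))"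

definition neg_semidef :: "real^'n^'n \<Rightarrow> bool" where
  "neg_semidef M \<longleftrightarrow> symmetric_matrix M \<and> (\<forall>x. x \<bullet> (M *v x) \<le> 0)"

text \<open>The library norm on \<open>real^'n^'m\<close> is the Frobenius norm.\<close>

lemma norm_matrix_eq_frobenius:
  fixes M :: "real^'n^'m"
  shows "norm M = sqrt (\<Sum>i\<in>UNIV. \<Sum>j\<in>UNIV. (M $ i $ j)\<^sup>2)"
  by (simp add: norm_vec_def L2_set_def sum_nonneg)

text \<open>Every state can be steered to every other state in finite time by some (here:
  continuous) input. For linear time-invariant systems, admitting piecewise continuous or
  integrable inputs gives the same notion.\<close>

definition controllable :: "real^'n^'n \<Rightarrow> real^'m^'n \<Rightarrow> bool" where
  "controllable A B \<longleftrightarrow>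
     (\<forall>x0 x1. \<exists>\<tau>>0. \<exists>(u :: real \<Rightarrow> real^'m) (x :: real \<Rightarrow> real^'n).
        continuous_on {0..\<tau>} u \<and> x 0 = x0 \<and> x \<tau> = x1 \<and>
        (\<forall>t\<in>{0..\<tau>}. (x has_vector_derivative A *v x t + B *v u t) (at t within {0..\<tau>})))"

text \<open>The search space: the matrix function matters only on \<open>{0..T}\<close>.\<close>

definition in_domain ::
  "real \<Rightarrow> (real \<Rightarrow> real^'n^'n) \<Rightarrow> real^'n^'n \<Rightarrow> real^'n^'n \<Rightarrow> bool" where
  "in_domain T Y Q YT \<longleftrightarrow>
     continuous_on {0..T} Y \<and> (\<forall>t\<in>{0..T}. symmetric_matrix (Y t)) \<and>
     symmetric_matrix Q \<and> symmetric_matrix YT"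

text \<open>Derivatives at the endpoints of \<open>{0..T}\<close> are one-sided.\<close>

definition state_equation ::
  "real^'n^'n \<Rightarrow> real \<Rightarrow> (real \<Rightarrow> real^'n^'n) \<Rightarrow> (real \<Rightarrow> real^'n^'n) \<Rightarrow> real^'n^'n \<Rightarrow> bool" where
  "state_equation A T G Y Q \<longleftrightarrow>
     (\<forall>t\<in>{0..T}. (Y has_vector_derivative
        - (transpose A ** Y t) - Y t ** A - Q - G t) (at t within {0..T}))"

definition feasible ::
  "real^'n^'n \<Rightarrow> real \<Rightarrow> (real \<Rightarrow> real^'n^'n) \<Rightarrow> real^'n^'n \<Rightarrow>
   (real \<Rightarrow> real^'n^'n) \<Rightarrow> real^'n^'n \<Rightarrow> real^'n^'n \<Rightarrow> bool" where
  "feasible A T G P0T Y Q YT \<longleftrightarrow>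
     in_domain T Y Q YT \<and> state_equation A T G Y Q \<and> Y T = YT \<and>
     pos_semidef Q \<and> pos_semidef (YT + P0T)"

definition objective :: "real^'m^'n \<Rightarrow> real \<Rightarrow> (real \<Rightarrow> real^'n^'n) \<Rightarrow> real" where
  "objective B T Y = 1/2 * integral {0..T} (\<lambda>t. (norm (transpose B ** Y t))\<^sup>2)"

definition optimal_solution ::
  "real^'n^'n \<Rightarrow> real^'m^'n \<Rightarrow> real \<Rightarrow> (real \<Rightarrow> real^'n^'n) \<Rightarrow> real^'n^'n \<Rightarrow>
   (real \<Rightarrow> real^'n^'n) \<Rightarrow> real^'n^'n \<Rightarrow> real^'n^'n \<Rightarrow> bool" where
  "optimal_solution A B T G P0T Y Q YT \<longleftrightarrow>
     feasible A T G P0T Y Q YT \<and>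
     (\<forall>Y' Q' YT'. feasible A T G P0T Y' Q' YT' \<longrightarrow> objective B T Y \<le> objective B T Y')"

end

theory Submission
  imports Defs
begin

text \<open>Along a variation \<open>X\<close> of the state equation caused by a change \<open>S\<close> of \<open>Q\<close>, the costate
  identity \<open>d/dt (\<Lambda> \<bullet> X + \<Omega> \<bullet> S) = - (B\<^sup>T Y) \<bullet> (B\<^sup>T X)\<close> gives the exact expansion
  \<open>J (Y + e X) = J Y - e (\<Lambda>(T) \<bullet> X(T) + \<Omega>(T) \<bullet> S) + e\<^sup>2 J X\<close>. As \<open>(X(T), S)\<close> can be prescribed
  freely, \<open>Y\<close> is optimal iff \<open>Y(T) + P\<^sub>0(T)\<close> and \<open>Q\<close> maximise \<open>\<Lambda>(T) \<bullet> M\<close> and \<open>\<Omega>(T) \<bullet> M\<close> over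
  the positive semidefinite cone, and that is complementary slackness plus negative
  semidefiniteness.\<close>

section \<open>Linear differential equations with constant coefficients\<close>

text \<open>A copy of the bounded linear operators, which the library does not make an algebra, so
  that \<open>exp\<close> becomes available for them.\<close>

typedef (overloaded) 'a endo = "UNIV :: ('a::euclidean_space \<Rightarrow>\<^sub>L 'a) set"
  morphisms endo_blinfun Endo by simp

setup_lifting type_definition_endo

instantiation endo :: (euclidean_space) real_normed_algebra_1
begin

lift_definition zero_endo :: "'a endo" is 0 .
lift_definition one_endo :: "'a endo" is id_blinfun .
lift_definition plus_endo :: "'a endo \<Rightarrow> 'a endo \<Rightarrow> 'a endo" is "(+)" .
lift_definition minus_endo :: "'a endo \<Rightarrow> 'a endo \<Rightarrow> 'a endo" is "(-)" .
lift_definition uminus_endo :: "'a endo \<Rightarrow> 'a endo" is uminus .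
lift_definition times_endo :: "'a endo \<Rightarrow> 'a endo \<Rightarrow> 'a endo" is "(o\<^sub>L)" .
lift_definition scaleR_endo :: "real \<Rightarrow> 'a endo \<Rightarrow> 'a endo" is "(*\<^sub>R)" .
lift_definition norm_endo :: "'a endo \<Rightarrow> real" is norm .

definition dist_endo :: "'a endo \<Rightarrow> 'a endo \<Rightarrow> real" where
  "dist_endo a b = norm (a - b)"
definition sgn_endo :: "'a endo \<Rightarrow> 'a endo" where
  "sgn_endo a = inverse (norm a) *\<^sub>R a"
definition [code del]:
  "(uniformity :: ('a endo \<times> 'a endo) filter) = (INF e\<in>{0<..}. principal {(x, y). dist x y < e})"
definition open_endo :: "'a endo set \<Rightarrow> bool" where [code del]:
  "open_endo U \<longleftrightarrow> (\<forall>x\<in>U. \<forall>\<^sub>F (x', y) in uniformity. x' = x \<longrightarrow> y \<in> U)"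

instance
proof
  fix a b c :: "'a endo" and r s :: real
  show "a * b * c = a * (b * c)"
    by transfer (auto intro: blinfun_eqI)
  show "1 * a = a" "a * 1 = a"
    by (transfer; auto intro: blinfun_eqI)+
  show "(a + b) * c = a * c + b * c" "a * (b + c) = a * b + a * c"
    by (transfer; rule blinfun_eqI; simp add: blinfun.bilinear_simps)+
  show "r *\<^sub>R a * b = r *\<^sub>R (a * b)" "a * r *\<^sub>R b = r *\<^sub>R (a * b)"
    by (transfer; rule blinfun_eqI; simp add: blinfun.bilinear_simps)+
  show "(0::'a endo) \<noteq> 1"
    by transfer (metis norm_blinfun_id norm_zero zero_neq_one)
  show "norm (a * b) \<le> norm a * norm b"
    by transfer (rule norm_blinfun_compose)
  show "norm (1::'a endo) = 1"
    by transfer simp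
  show "norm (a + b) \<le> norm a + norm b"
    by transfer (rule norm_triangle_ineq)
  show "a + b + c = a + (b + c)" "a + b = b + a" "0 + a = a" "- a + a = 0" "a - b = a + - b"
    by (transfer; simp)+
  show "r *\<^sub>R (a + b) = r *\<^sub>R a + r *\<^sub>R b" "(r + s) *\<^sub>R a = r *\<^sub>R a + s *\<^sub>R a"
    by (transfer; simp add: algebra_simps)+
  show "r *\<^sub>R s *\<^sub>R a = (r * s) *\<^sub>R a" "1 *\<^sub>R a = a"
    "norm a = 0 \<longleftrightarrow> a = 0" "norm (r *\<^sub>R a) = \<bar>r\<bar> * norm a"
    by (transfer; simp)+
qed (rule dist_endo_def sgn_endo_def uniformity_endo_def open_endo_def)+

end

text \<open>The norm is the operator norm, so \<open>endo_blinfun\<close> is an isometry and limits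
  carry over; completeness makes the exponential series converge.\<close>

instance endo :: (euclidean_space) banach
proof
  fix X :: "nat \<Rightarrow> 'a endo"
  assume X: "Cauchy X"
  have dist: "dist a b = dist (endo_blinfun a) (endo_blinfun b)" for a b :: "'a endo"
    by (simp add: dist_norm norm_endo.rep_eq minus_endo.rep_eq)
  have "Cauchy (\<lambda>n. endo_blinfun (X n))"
    using X by (simp add: Cauchy_def dist)
  then obtain l where "(\<lambda>n. endo_blinfun (X n)) \<longlonglongrightarrow> l"
    by (auto simp: Cauchy_convergent_iff convergent_def)
  then have "X \<longlonglongrightarrow> Endo l"
    by (simp add: tendsto_iff dist Endo_inverse)
  then show "convergent X"
    by (auto simp: convergent_def)
qed

lift_definition endo_apply :: "'a::euclidean_space endo \<Rightarrow> 'a \<Rightarrow> 'a" is blinfun_apply .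

lemma bounded_bilinear_endo_apply: "bounded_bilinear endo_apply"
proof
  show "\<exists>K. \<forall>a b. norm (endo_apply a b) \<le> norm a * norm b * K"
    by (rule exI[of _ 1]) (transfer, simp add: norm_blinfun)
qed (transfer; simp add: blinfun.bilinear_simps)+

lemma endo_apply_one [simp]: "endo_apply 1 x = x"
  by transfer simp

lemma endo_apply_mult: "endo_apply (a * b) x = endo_apply a (endo_apply b x)"
  by transfer simp

lemma linear_imp_endo_apply:
  assumes "linear f"
  obtains a where "endo_apply a = f"
proof
  show "endo_apply (Endo (Blinfun f)) = f"
    using assms
    by (simp add: endo_apply.rep_eq Endo_inverse bounded_linear_Blinfun_apply linear_conv_bounded_linear)
qed

text \<open>Variation of constants: with \<open>a\<close> the operator \<open>f\<close>, the
  solution is exp(ta) applied to the sum of x0 and the integral from 0 to t of exp(-sa) g(s);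
  \<open>h\<close> is the integrand, \<open>z\<close> the sum.\<close>

lemma linear_ode_solution_exists:
  fixes f :: "'a::euclidean_space \<Rightarrow> 'a" and g :: "real \<Rightarrow> 'a"
  assumes "linear f" and g: "continuous_on {0..T} g"
  obtains x where "x 0 = x0"
    and "\<And>t. t \<in> {0..T} \<Longrightarrow> (x has_vector_derivative f (x t) + g t) (at t within {0..T})"
proof -
  interpret app: bounded_bilinear "endo_apply :: 'a endo \<Rightarrow> _"
    by (rule bounded_bilinear_endo_apply)
  obtain a where a: "endo_apply a = f"
    using linear_imp_endo_apply assms(1) by blast
  define h where "h s = endo_apply (exp (s *\<^sub>R - a)) (g s)" for s
  define z where "z t = x0 + integral {0..t} h" for t
  define x where "x t = endo_apply (exp (t *\<^sub>R a)) (z t)" for t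
  have h: "continuous_on {0..T} h"
    unfolding h_def
    by (intro app.continuous_on g continuous_at_imp_continuous_on)
      (blast intro: has_vector_derivative_continuous exp_scaleR_has_vector_derivative_left)
  have "(x has_vector_derivative f (x t) + g t) (at t within {0..T})" if t: "t \<in> {0..T}" for t
  proof -
    have z': "(z has_vector_derivative h t) (at t within {0..T})"
      unfolding z_def using integral_has_vector_derivative[OF h t]
      by (auto intro!: derivative_eq_intros)
    have "(x has_vector_derivative
        endo_apply (exp (t *\<^sub>R a)) (h t) + endo_apply (a * exp (t *\<^sub>R a)) (z t)) (at t within {0..T})"
      unfolding x_def
      by (rule app.has_vector_derivative[OF _ z'])
        (rule has_vector_derivative_at_within[OF exp_scaleR_has_vector_derivative_left])
    moreover have "endo_apply (exp (t *\<^sub>R a)) (h t) = g t"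
      by (simp add: h_def flip: endo_apply_mult) (simp add: exp_minus_inverse)
    moreover have "endo_apply (a * exp (t *\<^sub>R a)) (z t) = f (x t)"
      by (simp add: endo_apply_mult x_def a)
    ultimately show ?thesis
      by (simp add: add.commute)
  qed
  moreover have "x 0 = x0"
    by (simp add: x_def z_def)
  ultimately show ?thesis
    using that by blast
qed

text \<open>Time reversal t -> T - t turns the terminal value into an initial value and changes the
  sign of the right-hand side. Variations are prescribed at \<open>T\<close>, hence this
  form.\<close>

lemma linear_ode_terminal_solution_exists:
  fixes f :: "'a::euclidean_space \<Rightarrow> 'a" and g :: "real \<Rightarrow> 'a"
  assumes "linear f" and g: "continuous_on {0..T} g"
  obtains x where "x T = xT"
    and "\<And>t. t \<in> {0..T} \<Longrightarrow> (x has_vector_derivative f (x t) + g t) (at t within {0..T})"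
proof -
  have "continuous_on {0..T} (\<lambda>t. - g (T - t))"
    by (intro continuous_intros continuous_on_compose2[OF g]) auto
  moreover have "linear (\<lambda>x. - f x)"
    using assms(1) by (rule linear_compose_neg)
  ultimately obtain y where y0: "y 0 = xT"
    and y: "\<And>t. t \<in> {0..T} \<Longrightarrow>
      (y has_vector_derivative - f (y t) + - g (T - t)) (at t within {0..T})"
    using linear_ode_solution_exists by blast
  define x where "x t = y (T - t)" for t
  have "(x has_vector_derivative f (x t) + g t) (at t within {0..T})" if t: "t \<in> {0..T}" for t
  proof -
    have img: "(-) T ` {0..T} = {0..T}"
      by simp
    have "((\<lambda>s. T - s) has_vector_derivative - 1) (at t within {0..T})"
      by (auto intro!: derivative_eq_intros)
    from vector_diff_chain_within[OF this, of y "- f (x t) + - g t"] y[of "T - t"] t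
    show ?thesis
      by (simp add: x_def[abs_def] img o_def algebra_simps)
  qed
  moreover have "x T = xT"
    by (simp add: x_def y0)
  ultimately show ?thesis
    using that by blast
qed

section \<open>The cone of positive semidefinite matrices\<close>

lemma inner_matrix_def: "X \<bullet> Y = (\<Sum>i\<in>UNIV. \<Sum>j\<in>UNIV. X $ i $ j * Y $ i $ j)"
  for X Y :: "real^'n^'m"
  by (simp add: inner_vec_def)

lemma inner_transpose: "transpose X \<bullet> Y = X \<bullet> transpose Y" for X :: "real^'n^'m"
  unfolding inner_matrix_def transpose_def
  by (subst sum.swap) simp

text \<open>A reordering of one triple sum. It and its right-hand twin shift \<open>A\<close> from
  the costate to the variation, where the terms in \<open>A\<close> cancel.\<close>

lemma inner_matrix_mult_left: "(A ** X) \<bullet> Y = X \<bullet> (transpose A ** Y)"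
  for A :: "real^'n^'m" and X :: "real^'k^'n"
proof -
  have "(A ** X) \<bullet> Y = (\<Sum>i\<in>UNIV. \<Sum>j\<in>UNIV. \<Sum>k\<in>UNIV. A $ i $ k * X $ k $ j * Y $ i $ j)"
    by (simp add: inner_matrix_def matrix_matrix_mult_def sum_distrib_right)
  also have "\<dots> = (\<Sum>i\<in>UNIV. \<Sum>k\<in>UNIV. \<Sum>j\<in>UNIV. A $ i $ k * X $ k $ j * Y $ i $ j)"
    by (intro sum.cong refl sum.swap)
  also have "\<dots> = (\<Sum>k\<in>UNIV. \<Sum>i\<in>UNIV. \<Sum>j\<in>UNIV. A $ i $ k * X $ k $ j * Y $ i $ j)"
    by (rule sum.swap)
  also have "\<dots> = (\<Sum>k\<in>UNIV. \<Sum>j\<in>UNIV. \<Sum>i\<in>UNIV. A $ i $ k * X $ k $ j * Y $ i $ j)"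
    by (intro sum.cong refl sum.swap)
  also have "\<dots> = X \<bullet> (transpose A ** Y)"
    by (simp add: inner_matrix_def matrix_matrix_mult_def transpose_def sum_distrib_left mult_ac)
  finally show ?thesis .
qed

lemma inner_matrix_mult_right: "(X ** A) \<bullet> Y = X \<bullet> (Y ** transpose A)"
  for A :: "real^'n^'m" and X :: "real^'m^'k"
proof -
  have "(X ** A) \<bullet> Y = (transpose A ** transpose X) \<bullet> transpose Y"
    by (simp add: inner_transpose flip: matrix_transpose_mul)
  also have "\<dots> = X \<bullet> (Y ** transpose A)"
    by (simp add: inner_matrix_mult_left inner_transpose matrix_transpose_mul)
  finally show ?thesis .
qed

lemma transpose_add: "transpose (X + Y) = transpose X + transpose Y" for X Y :: "real^'n^'m"
  by (simp add: transpose_def vec_eq_iff)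

lemma transpose_uminus: "transpose (- X) = - transpose X" for X :: "real^'n^'m"
  by (simp add: transpose_def vec_eq_iff)

lemma transpose_diff: "transpose (X - Y) = transpose X - transpose Y" for X Y :: "real^'n^'m"
  by (simp add: transpose_def vec_eq_iff)

lemma bounded_linear_transpose: "bounded_linear (transpose :: real^'n^'m \<Rightarrow> _)"
  by (auto intro!: linearI simp: transpose_add transpose_scalar simp flip: linear_conv_bounded_linear)

lemma linear_matrix_mult_left: "linear (\<lambda>X. A ** X)" for A :: "real^'n^'m"
  by (intro linearI) (simp_all add: matrix_add_ldistrib matrix_scalar_ac scalar_matrix_assoc)

lemma matrix_mult_add_right_distrib: "(X + Y) ** A = X ** A + Y ** A"
  for A :: "real^'n^'m"
  by (simp add: matrix_matrix_mult_def vec_eq_iff distrib_right sum.distrib)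

lemma linear_matrix_mult_right: "linear (\<lambda>X. X ** A)" for A :: "real^'n^'m"
  by (intro linearI) (simp_all add: matrix_mult_add_right_distrib scalar_matrix_assoc)

lemmas transpose_simps = transpose_add transpose_diff transpose_uminus transpose_scalar matrix_transpose_mul

lemmas matrix_mult_linear_simps =
  linear_matrix_mult_left[THEN linear_add] linear_matrix_mult_left[THEN linear_diff]
  linear_matrix_mult_left[THEN linear_neg] linear_matrix_mult_left[THEN linear_scale]
  linear_matrix_mult_right[THEN linear_add] linear_matrix_mult_right[THEN linear_diff]
  linear_matrix_mult_right[THEN linear_neg] linear_matrix_mult_right[THEN linear_scale]

section \<open>Rank-one matrices and semidefinite quadratic forms\<close>

definition outer :: "real^'n \<Rightarrow> real^'n^'n" where
  "outer x = (\<chi> i j. x $ i * x $ j)"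

lemma quadratic_form_eq: "x \<bullet> (M *v x) = (\<Sum>i\<in>UNIV. \<Sum>j\<in>UNIV. x $ i * M $ i $ j * x $ j)"
  for M :: "real^'n^'n"
  by (simp add: inner_vec_def matrix_vector_mult_def sum_distrib_left mult.assoc)

text \<open>Makes the quadratic form a linear functional of \<open>M\<close>: inequalities between
  inner products over the cone can then be tested on rank-one matrices.\<close>

lemma inner_outer: "M \<bullet> outer x = x \<bullet> (M *v x)"
  by (simp add: quadratic_form_eq inner_matrix_def outer_def mult_ac)

lemma outer_mult_vector: "outer x *v y = (x \<bullet> y) *\<^sub>R x"
  by (simp add: vec_eq_iff outer_def matrix_vector_mult_def inner_vec_def sum_distrib_left mult_ac)

lemma pos_semidef_outer: "pos_semidef (outer x)"
  by (simp add: pos_semidef_def symmetric_matrix_def outer_def transpose_def vec_eq_iff mult.commute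
      outer_mult_vector[unfolded outer_def] inner_commute)

lemma symmetric_matrix_inner_commute:
  assumes "symmetric_matrix M"
  shows "x \<bullet> (M *v y) = y \<bullet> (M *v x)"
  using assms
  by (metis dot_lmul_matrix inner_commute symmetric_matrix_def transpose_matrix_vector)

text \<open>Restricted to the span of x and y the form is a nonnegative binary quadratic form, which
  bounds its discriminant; the degenerate case a = 0 is treated apart.\<close>

lemma pos_semidef_cauchy_schwarz:
  assumes "pos_semidef M"
  shows "(x \<bullet> (M *v y))\<^sup>2 \<le> (x \<bullet> (M *v x)) * (y \<bullet> (M *v y))"
proof -
  define a b c where "a = x \<bullet> (M *v x)" and "b = x \<bullet> (M *v y)" and "c = y \<bullet> (M *v y)"
  have form: "0 \<le> s\<^sup>2 * a + 2 * s * t * b + t\<^sup>2 * c" for s t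
  proof -
    have "0 \<le> (s *\<^sub>R x + t *\<^sub>R y) \<bullet> (M *v (s *\<^sub>R x + t *\<^sub>R y))"
      using assms by (simp add: pos_semidef_def)
    also have "\<dots> = s\<^sup>2 * a + 2 * s * t * b + t\<^sup>2 * c"
      using symmetric_matrix_inner_commute[of M x y] assms
      by (simp add: a_def b_def c_def pos_semidef_def matrix_vector_right_distrib
          matrix_vector_mult_scaleR inner_left_distrib inner_right_distrib
          algebra_simps power2_eq_square)
    finally show ?thesis .
  qed
  have "b\<^sup>2 \<le> a * c"
  proof (cases "a = 0")
    case True
    have "b = 0"
    proof (rule ccontr)
      assume "b \<noteq> 0"
      \<comment> \<open>With a = 0 this choice of s, and t = 1, makes the form equal to -1.\<close>
      then show False
        using form[of "- (c + 1) / (2 * b)" 1] assms True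
        by (simp add: divide_simps split: if_splits)
    qed
    then show ?thesis
      using True by simp
  next
    case False
    then have "a > 0"
      using assms by (auto simp: a_def pos_semidef_def order_less_le)
    \<comment> \<open>At s = -b, t = a the form equals a (a c - b^2).\<close>
    moreover have "0 \<le> a * (a * c - b\<^sup>2)"
      using form[of "- b" a] by (simp add: algebra_simps power2_eq_square)
    ultimately show ?thesis
      by (simp add: zero_le_mult_iff)
  qed
  then show ?thesis
    by (simp add: a_def b_def c_def)
qed

lemma axis_matrix_axis: "axis i 1 \<bullet> (M *v axis j 1) = M $ i $ j" for M :: "real^'n^'n"
  by (simp add: inner_axis' matrix_vector_mult_basis column_def)

lemma axis_matrix: "axis i 1 \<bullet> (M *v x) = row i M \<bullet> x" for M :: "real^'n^'n"
  by (simp add: inner_axis' matrix_vector_mul_component row_def)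

text \<open>One step of symmetric Gaussian elimination: subtracting the rank-one matrix built from
  the row of a positive pivot clears that row and keeps the matrix positive semidefinite.\<close>

lemma pos_semidef_eliminate:
  assumes "pos_semidef M" and pos: "M $ i $ i > 0"
  shows "pos_semidef (M - (1 / M $ i $ i) *\<^sub>R outer (row i M))"
    (is "pos_semidef ?N")
proof -
  have "0 \<le> x \<bullet> (?N *v x)" for x
  proof -
    \<comment> \<open>Cauchy-Schwarz for the i-th unit vector and x; divided by the pivot it says
      that the rank-one term never exceeds the form of \<open>M\<close>.\<close>
    have "(row i M \<bullet> x)\<^sup>2 \<le> M $ i $ i * (x \<bullet> (M *v x))"
      using pos_semidef_cauchy_schwarz[OF assms(1), of "axis i 1" x]
      unfolding axis_matrix axis_matrix_axis[unfolded axis_matrix] .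
    then show ?thesis
      using pos
      by (simp add: matrix_vector_mult_diff_rdistrib scaleR_matrix_vector_assoc[symmetric]
          outer_mult_vector inner_diff_right inner_commute field_simps power2_eq_square)
  qed
  then show ?thesis
    using assms(1) pos_semidef_outer[of "row i M"]
    by (simp add: pos_semidef_def symmetric_matrix_def transpose_simps)
qed

text \<open>Repeated elimination peels off nonnegative multiples of rank-one matrices, each with
  nonnegative inner product with \<open>N\<close>. The number of nonzero rows drops each time, and
  when no pivot is left \<open>M\<close> is 0. This replaces a spectral decomposition.\<close>

lemma pos_semidef_inner_nonneg:
  assumes "pos_semidef M" and N: "pos_semidef N"
  shows "0 \<le> M \<bullet> N"
  using assms(1)
proof (induction "card {i. row i M \<noteq> 0}" arbitrary: M rule: less_induct)
  case less
  show ?case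
  proof (cases "\<exists>i. M $ i $ i > 0")
    case True
    then obtain i where i: "M $ i $ i > 0" ..
    let ?M' = "M - (1 / M $ i $ i) *\<^sub>R outer (row i M)"
    have sym: "M $ k $ l = M $ l $ k" for k l
      using less.prems by (auto simp: pos_semidef_def symmetric_matrix_def transpose_def vec_eq_iff)
    have "row i ?M' = 0"
      using i by (simp add: row_def outer_def vec_eq_iff)
    \<comment> \<open>A zero row k forces \<open>M $ i $ k = 0\<close> by symmetry, so the
      subtracted matrix has a zero row k too.\<close>
    moreover have "row k ?M' = 0" if "row k M = 0" for k
      using that sym[of i k] by (simp add: row_def outer_def vec_eq_iff)
    moreover have "row i M \<noteq> 0"
      using i by (auto simp: row_def vec_eq_iff intro!: exI[of _ i])
    ultimately have "{k. row k ?M' \<noteq> 0} \<subset> {k. row k M \<noteq> 0}"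
      by blast
    then have "0 \<le> ?M' \<bullet> N"
      using less.hyps[of ?M'] pos_semidef_eliminate[OF less.prems i]
      by (simp add: psubset_card_mono)
    moreover have "0 \<le> outer (row i M) \<bullet> N"
      using N by (simp add: inner_commute[of _ N] inner_outer pos_semidef_def)
    then have "0 \<le> (1 / M $ i $ i) * (outer (row i M) \<bullet> N)"
      using i by simp
    ultimately show ?thesis
      by (simp add: inner_diff_left)
  next
    case False
    have "0 \<le> M $ i $ i" for i
      using less.prems unfolding pos_semidef_def by (metis axis_matrix_axis)
    then have "M $ i $ i = 0" for i
      using False by (simp add: not_less order_antisym)
    \<comment> \<open>A zero diagonal forces zero entries everywhere by Cauchy-Schwarz.\<close>
    then have "M $ i $ j = 0" for i j
      using pos_semidef_cauchy_schwarz[OF less.prems, of "axis i 1" "axis j 1"]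
      by (simp add: axis_matrix_axis)
    then have "M = 0"
      by (simp add: vec_eq_iff)
    then show ?thesis
      by simp
  qed
qed

section \<open>Negative semidefiniteness and closure properties of the cone\<close>

lemma neg_semidef_iff: "neg_semidef M \<longleftrightarrow> pos_semidef (- M)"
  by (simp add: neg_semidef_def pos_semidef_def symmetric_matrix_def transpose_uminus
      matrix_vector_mult_def inner_vec_def sum_negf)

lemma neg_semidef_inner_nonpos: "neg_semidef N \<Longrightarrow> pos_semidef M \<Longrightarrow> N \<bullet> M \<le> 0"
  using pos_semidef_inner_nonneg[of "- N" M] by (simp add: neg_semidef_iff)

lemma symmetric_matrix_scaleR: "symmetric_matrix M \<Longrightarrow> symmetric_matrix (c *\<^sub>R M)"
  by (simp add: symmetric_matrix_def transpose_scalar)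

lemma symmetric_matrix_add: "symmetric_matrix M \<Longrightarrow> symmetric_matrix N \<Longrightarrow> symmetric_matrix (M + N)"
  by (simp add: symmetric_matrix_def transpose_add)

lemma symmetric_matrix_diff: "symmetric_matrix M \<Longrightarrow> symmetric_matrix N \<Longrightarrow> symmetric_matrix (M - N)"
  by (simp add: symmetric_matrix_def transpose_diff)

lemma pos_semidef_scaleR: "pos_semidef M \<Longrightarrow> 0 \<le> c \<Longrightarrow> pos_semidef (c *\<^sub>R M)"
  by (simp add: pos_semidef_def symmetric_matrix_scaleR scaleR_matrix_vector_assoc[symmetric])

lemma pos_semidef_add: "pos_semidef M \<Longrightarrow> pos_semidef N \<Longrightarrow> pos_semidef (M + N)"
  by (simp add: pos_semidef_def symmetric_matrix_add matrix_vector_mult_add_rdistrib inner_right_distrib)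

lemma pos_semidef_congruence:
  assumes "pos_semidef M"
  shows "pos_semidef (C ** M ** transpose C)"
proof -
  have "x \<bullet> ((C ** M ** transpose C) *v x) = (transpose C *v x) \<bullet> (M *v (transpose C *v x))" for x
    by (metis dot_lmul_matrix matrix_vector_mul_assoc transpose_matrix_vector transpose_transpose)
  then show ?thesis
    using assms
    by (simp add: pos_semidef_def symmetric_matrix_def matrix_transpose_mul matrix_mul_assoc)
qed

text \<open>For small e of the sign of a the linear term would be positive and dominate.\<close>

lemma quadratic_nonpos_imp_linear_coeff_zero:
  fixes a b :: real
  assumes "\<And>e. e * a + e\<^sup>2 * b \<le> 0"
  shows "a = 0"
proof (rule ccontr)
  assume "a \<noteq> 0"
  \<comment> \<open>This makes e a equal to e^2 (|b| + 1), which outweighs e^2 b for either sign of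
    b.\<close>
  define e where "e = a / (\<bar>b\<bar> + 1)"
  have "a = e * (\<bar>b\<bar> + 1)"
    by (simp add: e_def)
  then have "e * a + e\<^sup>2 * b = e\<^sup>2 * (\<bar>b\<bar> + 1 + b)"
    by (simp add: power2_eq_square algebra_simps)
  moreover have "0 < e\<^sup>2 * (\<bar>b\<bar> + 1 + b)"
    using \<open>a \<noteq> 0\<close> by (intro mult_pos_pos) (auto simp: e_def)
  ultimately show False
    using assms[of e] by simp
qed

text \<open>At a maximiser \<open>M\<close>, every congruence path \<open>(I + e C) M (I + e C)\<^sup>T\<close> stays in the
  cone for \<open>e\<close> of either sign, so its first-order term vanishes; this avoids any matrix square
  root or diagonalisation.\<close>

lemma pos_semidef_maximizer:
  assumes M: "pos_semidef M" and N: "symmetric_matrix N"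
    and max: "\<And>M'. pos_semidef M' \<Longrightarrow> N \<bullet> M' \<le> N \<bullet> M"
  shows "M ** N = 0" "neg_semidef N"
proof -
  have sM: "transpose M = M" and sN: "transpose N = N"
    using M N by (simp_all add: pos_semidef_def symmetric_matrix_def)
  have zero: "(M ** N) \<bullet> transpose C = 0" for C
  proof -
    \<comment> \<open>The exact change of the inner product with \<open>N\<close> along the
      congruence path; the two cross terms coincide because \<open>N\<close> is symmetric.\<close>
    have "e * (2 * (N \<bullet> (C ** M))) + e\<^sup>2 * (N \<bullet> (C ** M ** transpose C)) \<le> 0" for e
    proof -
      have "(mat 1 + e *\<^sub>R C) ** M ** transpose (mat 1 + e *\<^sub>R C) =
          M + e *\<^sub>R (C ** M + transpose (C ** M)) + e\<^sup>2 *\<^sub>R (C ** M ** transpose C)"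
        by (simp add: transpose_simps matrix_mult_linear_simps sM power2_eq_square algebra_simps)
      moreover have "N \<bullet> transpose (C ** M) = N \<bullet> (C ** M)"
        by (simp add: sN flip: inner_transpose)
      ultimately show ?thesis
        using max[OF pos_semidef_congruence[OF M, of "mat 1 + e *\<^sub>R C"]]
        by (simp add: inner_add_right algebra_simps)
    qed
    then have "N \<bullet> (C ** M) = 0"
      using quadratic_nonpos_imp_linear_coeff_zero by fastforce
    moreover have "(M ** N) \<bullet> transpose C = N \<bullet> (C ** M)"
    proof -
      have "(M ** N) \<bullet> transpose C = transpose (M ** N) \<bullet> C"
        by (simp add: inner_transpose)
      also have "\<dots> = N \<bullet> (C ** M)"
        by (simp add: matrix_transpose_mul sM sN inner_matrix_mult_right)
      finally show ?thesis .
    qed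
    ultimately show ?thesis
      by simp
  qed
  \<comment> \<open>C is arbitrary; taking its transpose to be \<open>M ** N\<close> makes the
    squared norm of \<open>M ** N\<close> vanish.\<close>
  show "M ** N = 0"
    using zero[of "transpose (M ** N)"] by simp
  \<comment> \<open>Adding a rank-one matrix keeps \<open>M\<close> in the cone, so maximality
    bounds the form of \<open>N\<close> above by 0.\<close>
  have "N \<bullet> outer x \<le> 0" for x
    using max[OF pos_semidef_add[OF M pos_semidef_outer[of x]]] by (simp add: inner_add_right)
  then show "neg_semidef N"
    using N by (simp add: neg_semidef_def inner_outer)
qed

section \<open>The costate and the perturbed objective\<close>

text \<open>Collects only the conditions that every continuous \<open>Y\<close> admits; the signs
  and the complementarity at \<open>T\<close>, which single out the optimal \<open>Y\<close>, stay
  outside.\<close>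

definition adjoint_system ::
  "real^'n^'n \<Rightarrow> real^'m^'n \<Rightarrow> real \<Rightarrow> (real \<Rightarrow> real^'n^'n) \<Rightarrow>
   (real \<Rightarrow> real^'n^'n) \<Rightarrow> (real \<Rightarrow> real^'n^'n) \<Rightarrow> bool" where
  "adjoint_system A B T Y \<Lambda> \<Omega> \<longleftrightarrow>
     (\<forall>t\<in>{0..T}. symmetric_matrix (\<Lambda> t) \<and> symmetric_matrix (\<Omega> t)) \<and>
     (\<forall>t\<in>{0..T}. (\<Lambda> has_vector_derivative
        - ((1/2) *\<^sub>R (B ** transpose B ** Y t + transpose (Y t) ** B ** transpose B))
        + transpose (\<Lambda> t) ** transpose A + A ** transpose (\<Lambda> t)) (at t within {0..T})) \<and>
     (\<forall>t\<in>{0..T}. (\<Omega> has_vector_derivative \<Lambda> t) (at t within {0..T})) \<and>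
     \<Lambda> 0 = 0 \<and> \<Omega> 0 = 0"

lemma has_vector_derivative_symmetrize:
  fixes X :: "real \<Rightarrow> real^'n^'n"
  assumes "(X has_vector_derivative X') F"
  shows "((\<lambda>t. (1/2) *\<^sub>R (X t + transpose (X t))) has_vector_derivative
    (1/2) *\<^sub>R (X' + transpose X')) F"
  by (intro bounded_linear.has_vector_derivative[OF bounded_linear_scaleR_right]
      has_vector_derivative_add bounded_linear.has_vector_derivative[OF bounded_linear_transpose] assms)

lemma symmetric_matrix_symmetrize: "symmetric_matrix ((1/2) *\<^sub>R (X + transpose X))"
  by (simp add: symmetric_matrix_def transpose_simps add.commute)

text \<open>The costate equation is invariant under transposition, so averaging a solution with its
  transpose gives a symmetric one, without an appeal to uniqueness.\<close>

lemma adjoint_system_solution_exists: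
  fixes A :: "real^'n^'n" and B :: "real^'m^'n"
  assumes Y: "continuous_on {0..T} Y"
  obtains \<Lambda> \<Omega> where "adjoint_system A B T Y \<Lambda> \<Omega>"
proof -
  define R where "R t = (1/2) *\<^sub>R (B ** transpose B ** Y t + transpose (Y t) ** B ** transpose B)" for t
  have R_sym: "transpose (R t) = R t" for t
    by (simp add: R_def transpose_simps matrix_mul_assoc add.commute)
  define f where "f X = X ** transpose A + A ** X" for X
  have f: "linear f"
    unfolding f_def by (intro linear_compose_add linear_matrix_mult_left linear_matrix_mult_right)
  have "continuous_on {0..T} (\<lambda>t. - R t)"
    unfolding R_def
    by (intro continuous_intros Y
        linear_continuous_on_compose[OF _ linear_matrix_mult_right]
        linear_continuous_on_compose[OF _ linear_matrix_mult_left]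
        linear_continuous_on_compose[OF Y bounded_linear.linear[OF bounded_linear_transpose]])
  from linear_ode_solution_exists[OF f this] obtain X where X0: "X 0 = 0"
    and X: "\<And>t. t \<in> {0..T} \<Longrightarrow> (X has_vector_derivative f (X t) + - R t) (at t within {0..T})"
    by metis
  define \<Lambda> where "\<Lambda> t = (1/2) *\<^sub>R (X t + transpose (X t))" for t
  define \<Omega> where "\<Omega> t = integral {0..t} \<Lambda>" for t
  have \<Lambda>_sym: "transpose (\<Lambda> t) = \<Lambda> t" for t
    using symmetric_matrix_symmetrize by (simp add: \<Lambda>_def symmetric_matrix_def)
  have \<Lambda>': "(\<Lambda> has_vector_derivative - R t + \<Lambda> t ** transpose A + A ** \<Lambda> t) (at t within {0..T})"
    if "t \<in> {0..T}" for t
  proof -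
    have "(1/2) *\<^sub>R ((f (X t) + - R t) + transpose (f (X t) + - R t)) =
        - R t + \<Lambda> t ** transpose A + A ** \<Lambda> t"
      by (simp add: f_def \<Lambda>_def transpose_simps R_sym matrix_mult_linear_simps vec_eq_iff field_simps)
    then show ?thesis
      using has_vector_derivative_symmetrize[OF X[OF that]] unfolding \<Lambda>_def[abs_def] by simp
  qed
  have \<Lambda>_cont: "continuous_on {0..T} \<Lambda>"
    by (rule continuous_on_vector_derivative) (rule \<Lambda>')
  have "transpose (\<Omega> t) = \<Omega> t" if "t \<in> {0..T}" for t
  proof -
    \<comment> \<open>Transposition is bounded linear and passes under the integral, so symmetry of
      \<Lambda> gives that of \<Omega>.\<close>
    have "\<Lambda> integrable_on {0..t}"
      using \<Lambda>_cont that by (intro integrable_continuous_real continuous_on_subset[OF \<Lambda>_cont]) auto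
    from integral_linear[OF this bounded_linear_transpose, symmetric] show ?thesis
      unfolding \<Omega>_def o_def \<Lambda>_sym .
  qed
  moreover have "(\<Omega> has_vector_derivative \<Lambda> t) (at t within {0..T})" if "t \<in> {0..T}" for t
    unfolding \<Omega>_def using \<Lambda>_cont that by (rule integral_has_vector_derivative)
  moreover have "\<Lambda> 0 = 0"
    by (simp add: \<Lambda>_def X0 transpose_def vec_eq_iff)
  moreover have "\<Omega> 0 = 0"
    by (simp add: \<Omega>_def)
  ultimately have "adjoint_system A B T Y \<Lambda> \<Omega>"
    using \<Lambda>' by (simp add: adjoint_system_def symmetric_matrix_def \<Lambda>_sym R_def)
  then show ?thesis
    by (rule that)
qed

text \<open>Supplies the directions of change: any symmetric terminal value together with any
  symmetric change of \<open>Q\<close>. Solved backwards from \<open>T\<close> and symmetrised as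
  for the costate.\<close>

lemma variation_solution_exists:
  fixes A S D :: "real^'n^'n"
  assumes S: "symmetric_matrix S" and D: "symmetric_matrix D"
  obtains X where "X T = D" "\<forall>t. symmetric_matrix (X t)" "state_equation A T (\<lambda>t. 0) X S"
proof -
  define f where "f X = - (transpose A ** X) - X ** A" for X
  have f: "linear f"
    unfolding f_def
    by (intro linear_compose_sub linear_compose_neg linear_matrix_mult_left linear_matrix_mult_right)
  obtain Z where ZT: "Z T = D"
    and Z: "\<And>t. t \<in> {0..T} \<Longrightarrow> (Z has_vector_derivative f (Z t) + - S) (at t within {0..T})"
    using linear_ode_terminal_solution_exists[OF f continuous_on_const] by metis
  define X where "X t = (1/2) *\<^sub>R (Z t + transpose (Z t))" for t
  have "(X has_vector_derivative - (transpose A ** X t) - X t ** A - S - 0) (at t within {0..T})"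
    if "t \<in> {0..T}" for t
  proof -
    have "(1/2) *\<^sub>R ((f (Z t) + - S) + transpose (f (Z t) + - S)) =
        - (transpose A ** X t) - X t ** A - S - 0"
      using S
      by (simp add: f_def X_def transpose_simps matrix_mult_linear_simps symmetric_matrix_def
          vec_eq_iff field_simps)
    then show ?thesis
      using has_vector_derivative_symmetrize[OF Z[OF that]] unfolding X_def[abs_def] by simp
  qed
  moreover have "X T = D"
    using D by (simp add: X_def ZT symmetric_matrix_def flip: scaleR_2)
  moreover have "\<forall>t. symmetric_matrix (X t)"
    unfolding X_def by (blast intro: symmetric_matrix_symmetrize)
  ultimately show ?thesis
    by (intro that) (auto simp only: state_equation_def)
qed

section \<open>The objective along a variation\<close>

lemma state_equation_imp_continuous_on: "state_equation A T G Y Q \<Longrightarrow> continuous_on {0..T} Y"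
  unfolding state_equation_def by (rule continuous_on_vector_derivative) (rule bspec)

text \<open>The fundamental theorem of calculus for -(\<Lambda> \<bullet> X + \<Omega> \<bullet> S),
  which is 0 at time 0. In its derivative the terms in \<open>A\<close> cancel by adjointness, and
  the derivative \<Lambda> of \<Omega> absorbs the \<open>S\<close> in \<open>X'\<close>.\<close>

lemma has_integral_variation:
  fixes A :: "real^'n^'n" and B :: "real^'m^'n"
  assumes "0 \<le> T" and adj: "adjoint_system A B T Y \<Lambda> \<Omega>"
    and Y: "\<forall>t\<in>{0..T}. symmetric_matrix (Y t)"
    and X: "\<forall>t\<in>{0..T}. symmetric_matrix (X t)" "state_equation A T (\<lambda>t. 0) X S"
  shows "((\<lambda>t. (transpose B ** Y t) \<bullet> (transpose B ** X t)) has_integral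
    - (\<Lambda> T \<bullet> X T + \<Omega> T \<bullet> S)) {0..T}"
proof -
  define W where "W = B ** transpose B"
  have "((\<lambda>t. - (\<Lambda> t \<bullet> X t + \<Omega> t \<bullet> S)) has_vector_derivative
      (transpose B ** Y t) \<bullet> (transpose B ** X t)) (at t within {0..T})" if t: "t \<in> {0..T}" for t
  proof -
    have sym: "transpose (Y t) = Y t" "transpose (X t) = X t" "transpose (\<Lambda> t) = \<Lambda> t"
      using Y X adj t by (auto simp: adjoint_system_def symmetric_matrix_def)
    have W: "(transpose B ** Y t) \<bullet> (transpose B ** X t) = (W ** Y t) \<bullet> X t"
      by (simp add: W_def inner_matrix_mult_left matrix_mul_assoc[symmetric])
    \<comment> \<open>Both halves of the costate source have the same inner product with the
      symmetric \<open>X\<close>, so the factor 1/2 disappears.\<close>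
    have YW: "(Y t ** W) \<bullet> X t = (W ** Y t) \<bullet> X t"
      using inner_transpose[of "W ** Y t" "X t"]
      by (simp add: matrix_transpose_mul sym W_def)
    define L' where "L' = - ((1/2) *\<^sub>R (W ** Y t + Y t ** W)) + \<Lambda> t ** transpose A + A ** \<Lambda> t"
    define X' where "X' = - (transpose A ** X t) - X t ** A - S"
    have "(\<Lambda> has_vector_derivative L') (at t within {0..T})"
      "(\<Omega> has_vector_derivative \<Lambda> t) (at t within {0..T})"
      using adj[unfolded adjoint_system_def, THEN conjunct2, THEN conjunct1, THEN bspec, OF t]
        adj t sym
      by (simp_all add: adjoint_system_def L'_def W_def matrix_mul_assoc)
    moreover have "(X has_vector_derivative X') (at t within {0..T})"
      using X(2) t by (auto simp: state_equation_def X'_def)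
    ultimately have "((\<lambda>t. - (\<Lambda> t \<bullet> X t + \<Omega> t \<bullet> S)) has_vector_derivative
        - ((\<Lambda> t \<bullet> X' + L' \<bullet> X t) + \<Lambda> t \<bullet> S)) (at t within {0..T})"
      by (intro has_vector_derivative_minus has_vector_derivative_add
          bounded_bilinear.has_vector_derivative[OF bounded_bilinear_inner]
          bounded_linear.has_vector_derivative[OF bounded_linear_inner_left])
    moreover have "- ((\<Lambda> t \<bullet> X' + L' \<bullet> X t) + \<Lambda> t \<bullet> S) = (transpose B ** Y t) \<bullet> (transpose B ** X t)"
      by (simp add: W YW L'_def X'_def inner_add_left inner_diff_left inner_diff_right
          inner_matrix_mult_left[of A]
          inner_matrix_mult_right[of _ "transpose A"])
    ultimately show ?thesis
      by simp
  qed
  from fundamental_theorem_of_calculus[OF assms(1) this] show ?thesis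
    using adj by (simp add: adjoint_system_def)
qed

lemma objective_perturbation:
  fixes A :: "real^'n^'n" and B :: "real^'m^'n"
  assumes "0 \<le> T" and adj: "adjoint_system A B T Y \<Lambda> \<Omega>"
    and Y: "\<forall>t\<in>{0..T}. symmetric_matrix (Y t)" "continuous_on {0..T} Y"
    and X: "\<forall>t\<in>{0..T}. symmetric_matrix (X t)" "state_equation A T (\<lambda>t. 0) X S"
  shows "objective B T (\<lambda>t. Y t + e *\<^sub>R X t) =
    objective B T Y - e * (\<Lambda> T \<bullet> X T + \<Omega> T \<bullet> S) + e\<^sup>2 * objective B T X"
proof -
  define I where "I Z = integral {0..T} (\<lambda>t. (norm (transpose B ** Z t))\<^sup>2)"
    for Z :: "real \<Rightarrow> real^'n^'n"
  have int: "((\<lambda>t. (norm (transpose B ** Z t))\<^sup>2) has_integral I Z) {0..T}"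
    if "continuous_on {0..T} Z" for Z :: "real \<Rightarrow> real^'n^'n"
    unfolding I_def
    by (intro integrable_integral integrable_continuous_real continuous_intros
        linear_continuous_on_compose[OF that linear_matrix_mult_left])
  \<comment> \<open>Only the cross term needs the costate; its factor 2 cancels against the 1/2 in
    the objective.\<close>
  have "((\<lambda>t. (norm (transpose B ** Y t))\<^sup>2 +
      (2 * e * ((transpose B ** Y t) \<bullet> (transpose B ** X t)) + e\<^sup>2 * (norm (transpose B ** X t))\<^sup>2))
      has_integral I Y + (2 * e * - (\<Lambda> T \<bullet> X T + \<Omega> T \<bullet> S) + e\<^sup>2 * I X)) {0..T}"
    by (intro has_integral_add has_integral_mult_right int Y state_equation_imp_continuous_on[OF X(2)]
        has_integral_variation[OF assms(1) adj Y(1) X])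
  moreover have "(norm (transpose B ** (Y t + e *\<^sub>R X t)))\<^sup>2 = (norm (transpose B ** Y t))\<^sup>2 +
      (2 * e * ((transpose B ** Y t) \<bullet> (transpose B ** X t)) + e\<^sup>2 * (norm (transpose B ** X t))\<^sup>2)" for t
    unfolding power2_norm_eq_inner
    by (simp add: matrix_mult_linear_simps inner_add_left inner_add_right
        inner_commute power2_eq_square algebra_simps)
  ultimately have "I (\<lambda>t. Y t + e *\<^sub>R X t) = I Y + (2 * e * - (\<Lambda> T \<bullet> X T + \<Omega> T \<bullet> S) + e\<^sup>2 * I X)"
    by (simp add: I_def integral_unique)
  then show ?thesis
    by (simp add: objective_def I_def algebra_simps)
qed

lemma objective_nonneg: "0 \<le> objective B T X"
proof (cases "(\<lambda>t. (norm (transpose B ** X t))\<^sup>2) integrable_on {0..T}")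
  case True
  then show ?thesis
    by (simp add: objective_def integral_nonneg)
next
  \<comment> \<open>The integral of a non-integrable function is 0 by default.\<close>
  case False
  then show ?thesis
    by (simp add: objective_def not_integrable_integral)
qed

text \<open>The inhomogeneity \<open>G\<close> is common to both and cancels, so feasible
  trajectories differ by a variation.\<close>

lemma state_equation_diff:
  assumes "state_equation A T G Y Q" "state_equation A T G Y' Q'"
  shows "state_equation A T (\<lambda>t. 0) (\<lambda>t. Y' t - Y t) (Q' - Q)"
  unfolding state_equation_def
proof
  fix t assume "t \<in> {0..T}"
  then have "((\<lambda>t. Y' t - Y t) has_vector_derivative
      (- (transpose A ** Y' t) - Y' t ** A - Q' - G t) - (- (transpose A ** Y t) - Y t ** A - Q - G t))
      (at t within {0..T})"
    using assms unfolding state_equation_def by (intro has_vector_derivative_diff) auto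
  then show "((\<lambda>t. Y' t - Y t) has_vector_derivative
      - (transpose A ** (Y' t - Y t)) - (Y' t - Y t) ** A - (Q' - Q) - 0) (at t within {0..T})"
    by (simp add: matrix_mult_linear_simps algebra_simps)
qed

lemma state_equation_add_variation:
  assumes "state_equation A T G Y Q" "state_equation A T (\<lambda>t. 0) X S"
  shows "state_equation A T G (\<lambda>t. Y t + e *\<^sub>R X t) (Q + e *\<^sub>R S)"
  unfolding state_equation_def
proof
  fix t assume "t \<in> {0..T}"
  then have "((\<lambda>t. Y t + e *\<^sub>R X t) has_vector_derivative
      (- (transpose A ** Y t) - Y t ** A - Q - G t) + e *\<^sub>R (- (transpose A ** X t) - X t ** A - S - 0))
      (at t within {0..T})"
    using assms unfolding state_equation_def
    by (intro has_vector_derivative_add bounded_linear.has_vector_derivative[OF bounded_linear_scaleR_right]) auto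
  then show "((\<lambda>t. Y t + e *\<^sub>R X t) has_vector_derivative
      - (transpose A ** (Y t + e *\<^sub>R X t)) - (Y t + e *\<^sub>R X t) ** A - (Q + e *\<^sub>R S) - G t) (at t within {0..T})"
    by (simp add: matrix_mult_linear_simps algebra_simps)
qed

section \<open>Optimality and complementary slackness\<close>

text \<open>First-order condition: the segment from the optimum towards any cone points
  \<open>Q'\<close>, \<open>M'\<close> is feasible by convexity, and a positive first-order gain
  would beat the quadratic cost for small e.\<close>

lemma optimal_imp_variational_inequality:
  fixes A :: "real^'n^'n" and B :: "real^'m^'n"
  assumes T: "0 \<le> T" and adj: "adjoint_system A B T Y \<Lambda> \<Omega>"
    and opt: "optimal_solution A B T G P Y Q (Y T)"
    and P: "symmetric_matrix P" and Q': "pos_semidef Q'" and M': "pos_semidef M'"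
  shows "\<Lambda> T \<bullet> (M' - (Y T + P)) + \<Omega> T \<bullet> (Q' - Q) \<le> 0"
proof (rule ccontr)
  define S D where "S = Q' - Q" and "D = M' - (Y T + P)"
  have feas: "feasible A T G P Y Q (Y T)"
    and min: "\<And>Y' Q' YT'. feasible A T G P Y' Q' YT' \<Longrightarrow> objective B T Y \<le> objective B T Y'"
    using opt by (auto simp: optimal_solution_def)
  then have Q: "pos_semidef Q" "pos_semidef (Y T + P)"
    and Y: "\<forall>t\<in>{0..T}. symmetric_matrix (Y t)" "continuous_on {0..T} Y" "state_equation A T G Y Q"
    by (auto simp: feasible_def in_domain_def)
  have SD: "symmetric_matrix S" "symmetric_matrix D"
    using Q Q' M' by (simp_all add: S_def D_def symmetric_matrix_diff pos_semidef_def)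
  then obtain X where X: "X T = D" "\<forall>t. symmetric_matrix (X t)" "state_equation A T (\<lambda>t. 0) X S"
    using variation_solution_exists by blast
  define c where "c = \<Lambda> T \<bullet> D + \<Omega> T \<bullet> S"
  have le: "e * c \<le> e\<^sup>2 * objective B T X" if e: "0 \<le> e" "e \<le> 1" for e
  proof -
    \<comment> \<open>Convex combinations stay in the cone; in terms of \<open>S\<close> and
      \<open>D\<close> they are the perturbed \<open>Q\<close> and the perturbed terminal value plus
      \<open>P\<close>.\<close>
    have "pos_semidef ((1 - e) *\<^sub>R Q + e *\<^sub>R Q')" "pos_semidef ((1 - e) *\<^sub>R (Y T + P) + e *\<^sub>R M')"
      using e Q Q' M' by (simp_all add: pos_semidef_add pos_semidef_scaleR)
    moreover have "(1 - e) *\<^sub>R Q + e *\<^sub>R Q' = Q + e *\<^sub>R S"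
      "(1 - e) *\<^sub>R (Y T + P) + e *\<^sub>R M' = Y T + e *\<^sub>R X T + P"
      by (simp_all add: S_def D_def X(1) algebra_simps)
    ultimately have "feasible A T G P (\<lambda>t. Y t + e *\<^sub>R X t) (Q + e *\<^sub>R S) (Y T + e *\<^sub>R X T)"
      using T Y X state_equation_add_variation[OF Y(3) X(3), of e]
      by (auto simp: feasible_def in_domain_def pos_semidef_def intro!: symmetric_matrix_add
          symmetric_matrix_scaleR continuous_intros state_equation_imp_continuous_on[OF X(3)])
    from min[OF this] show ?thesis
      using objective_perturbation[OF T adj Y(1,2) _ X(3), of e] X by (simp add: c_def)
  qed
  assume "\<not> ?thesis"
  then have c: "0 < c"
    by (simp add: c_def S_def D_def)
  define k where "k = objective B T X"
  \<comment> \<open>Small enough that e k < c, and at most 1 so that the perturbed point is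
    feasible.\<close>
  define e where "e = c / (c + k + 1)"
  have k: "0 \<le> k"
    by (simp add: k_def objective_nonneg)
  then have e: "0 < e" "e \<le> 1"
    using c by (simp_all add: e_def)
  then have "c \<le> e * k"
    using le[of e] by (simp add: k_def power2_eq_square)
  moreover have "e * k < c"
    using c k by (simp add: e_def field_simps add_pos_nonneg)
  ultimately show False
    by simp
qed

text \<open>The two variables decouple: keeping one at its optimal value leaves a linear
  maximisation over the cone in the other, which \<open>pos_semidef_maximizer\<close>
  settles.\<close>

lemma optimal_imp_complementary:
  fixes A :: "real^'n^'n" and B :: "real^'m^'n"
  assumes T: "0 \<le> T" and adj: "adjoint_system A B T Y \<Lambda> \<Omega>"
    and opt: "optimal_solution A B T G P Y Q (Y T)" and P: "symmetric_matrix P"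
  shows "Q ** \<Omega> T = 0" "neg_semidef (\<Omega> T)" "(Y T + P) ** \<Lambda> T = 0" "neg_semidef (\<Lambda> T)"
proof -
  have psd: "pos_semidef Q" "pos_semidef (Y T + P)"
    using opt by (auto simp: optimal_solution_def feasible_def)
  have sym: "symmetric_matrix (\<Omega> T)" "symmetric_matrix (\<Lambda> T)"
    using adj T by (auto simp: adjoint_system_def)
  note ineq = optimal_imp_variational_inequality[OF T adj opt P]
  have "\<Omega> T \<bullet> Q' \<le> \<Omega> T \<bullet> Q" if "pos_semidef Q'" for Q'
    using ineq[OF that psd(2)] by (simp add: inner_diff_right)
  from pos_semidef_maximizer[OF psd(1) sym(1) this] show "Q ** \<Omega> T = 0" "neg_semidef (\<Omega> T)"
    by auto
  have "\<Lambda> T \<bullet> M' \<le> \<Lambda> T \<bullet> (Y T + P)" if "pos_semidef M'" for M'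
    using ineq[OF psd(1) that] by (simp add: inner_diff_right)
  from pos_semidef_maximizer[OF psd(2) sym(2) this]
  show "(Y T + P) ** \<Lambda> T = 0" "neg_semidef (\<Lambda> T)"
    by auto
qed

section \<open>Sufficiency of the conditions, and the equivalence\<close>

lemma inner_eq_zero_if_mult_eq_zero:
  assumes "symmetric_matrix M" "M ** N = 0"
  shows "N \<bullet> M = 0"
proof -
  \<comment> \<open>The inner product is the trace of the transpose of \<open>M\<close> times
    \<open>N\<close>, written as an inner product with the identity.\<close>
  have "N \<bullet> M = (transpose M ** N) \<bullet> mat 1"
    by (simp add: inner_matrix_mult_left)
  then show ?thesis
    using assms by (simp add: symmetric_matrix_def)
qed

text \<open>The expansion is exact, so e = 1 reaches an arbitrary feasible competitor:
  complementarity and duality of the cone make the linear contribution nonnegative, and the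
  quadratic one is nonnegative too.\<close>

lemma complementary_imp_optimal:
  fixes A :: "real^'n^'n" and B :: "real^'m^'n"
  assumes T: "0 \<le> T" and adj: "adjoint_system A B T Y \<Lambda> \<Omega>"
    and feas: "feasible A T G P Y Q (Y T)"
    and comp: "Q ** \<Omega> T = 0" "(Y T + P) ** \<Lambda> T = 0"
    and neg: "neg_semidef (\<Omega> T)" "neg_semidef (\<Lambda> T)"
  shows "optimal_solution A B T G P Y Q (Y T)"
  unfolding optimal_solution_def
proof (intro conjI allI impI feas)
  fix Y' Q' YT' assume feas': "feasible A T G P Y' Q' YT'"
  define X where "X t = Y' t - Y t" for t
  have Y: "\<forall>t\<in>{0..T}. symmetric_matrix (Y t)" "continuous_on {0..T} Y"
    and "symmetric_matrix Q" "symmetric_matrix (Y T + P)"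
    using feas by (auto simp: feasible_def in_domain_def pos_semidef_def)
  then have zero: "\<Omega> T \<bullet> Q = 0" "\<Lambda> T \<bullet> (Y T + P) = 0"
    using comp by (auto intro: inner_eq_zero_if_mult_eq_zero)
  have "\<Omega> T \<bullet> Q' \<le> 0" "\<Lambda> T \<bullet> (Y' T + P) \<le> 0"
    using feas' neg by (auto simp: feasible_def intro: neg_semidef_inner_nonpos)
  \<comment> \<open>\<open>X T\<close> is also the difference of the terminal values shifted by
    \<open>P\<close>, for which the cone conditions are stated.\<close>
  with zero have "\<Lambda> T \<bullet> X T + \<Omega> T \<bullet> (Q' - Q) \<le> 0"
    by (simp add: X_def inner_diff_right inner_add_right)
  moreover have "objective B T (\<lambda>t. Y t + 1 *\<^sub>R X t) =
      objective B T Y - 1 * (\<Lambda> T \<bullet> X T + \<Omega> T \<bullet> (Q' - Q)) + 1\<^sup>2 * objective B T X"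
    using feas feas' unfolding X_def
    by (intro objective_perturbation[OF T adj Y] state_equation_diff)
      (auto simp: feasible_def in_domain_def intro: symmetric_matrix_diff)
  moreover have "(\<lambda>t. Y t + 1 *\<^sub>R X t) = Y'"
    by (simp add: X_def)
  ultimately show "objective B T Y \<le> objective B T Y'"
    using objective_nonneg[of B T X] by simp
qed

theorem mainTheorem7:
  fixes A :: "real^'n^'n" and B :: "real^'m^'n" and T :: real
    and G :: "real \<Rightarrow> real^'n^'n" and P0T :: "real^'n^'n"
    and Y :: "real \<Rightarrow> real^'n^'n" and Q YT :: "real^'n^'n"
  assumes "controllable A B"
    and "rank B = CARD('m)"
    and "0 < T"
    and "continuous_on {0..T} G"
    and "\<forall>t\<in>{0..T}. symmetric_matrix (G t)"
    and "symmetric_matrix P0T"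
    and "in_domain T Y Q YT"
    and "YT = Y T"
  shows "optimal_solution A B T G P0T Y Q YT \<longleftrightarrow>
    (\<exists>(\<Lambda> :: real \<Rightarrow> real^'n^'n) (\<Omega> :: real \<Rightarrow> real^'n^'n).
       (\<forall>t\<in>{0..T}. symmetric_matrix (\<Lambda> t) \<and> symmetric_matrix (\<Omega> t)) \<and>
       state_equation A T G Y Q \<and>
       (\<forall>t\<in>{0..T}. (\<Lambda> has_vector_derivative
          - ((1/2) *\<^sub>R (B ** transpose B ** Y t + transpose (Y t) ** B ** transpose B))
          + transpose (\<Lambda> t) ** transpose A + A ** transpose (\<Lambda> t)) (at t within {0..T})) \<and>
       (\<forall>t\<in>{0..T}. (\<Omega> has_vector_derivative \<Lambda> t) (at t within {0..T})) \<and>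
       \<Lambda> 0 = 0 \<and> \<Omega> 0 = 0 \<and>
       Q ** \<Omega> T = 0 \<and> (YT + P0T) ** \<Lambda> T = 0 \<and>
       neg_semidef (\<Omega> T) \<and> pos_semidef Q \<and>
       neg_semidef (\<Lambda> T) \<and> pos_semidef (YT + P0T))"
    (is "_ \<longleftrightarrow> ?rhs")
proof (intro iffI)
  assume opt: "optimal_solution A B T G P0T Y Q YT"
  then have feas: "feasible A T G P0T Y Q YT"
    by (simp add: optimal_solution_def)
  \<comment> \<open>A costate exists for every continuous \<open>Y\<close>, so optimality enters
    only through feasibility and the conditions at \<open>T\<close>.\<close>
  obtain \<Lambda> \<Omega> where adj: "adjoint_system A B T Y \<Lambda> \<Omega>"
    using adjoint_system_solution_exists assms(7) unfolding in_domain_def by metis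
  have "0 \<le> T"
    using \<open>0 < T\<close> by simp
  note optimal_imp_complementary[OF this adj opt[unfolded \<open>YT = Y T\<close>] \<open>symmetric_matrix P0T\<close>]
  with adj feas show ?rhs
    unfolding adjoint_system_def feasible_def \<open>YT = Y T\<close> by blast
next
  assume ?rhs
  then obtain \<Lambda> \<Omega> where adj: "adjoint_system A B T Y \<Lambda> \<Omega>"
    and "state_equation A T G Y Q" "pos_semidef Q" "pos_semidef (YT + P0T)"
    and comp: "Q ** \<Omega> T = 0" "(YT + P0T) ** \<Lambda> T = 0"
    and neg: "neg_semidef (\<Omega> T)" "neg_semidef (\<Lambda> T)"
    unfolding adjoint_system_def by blast
  then have "feasible A T G P0T Y Q (Y T)"
    using assms(7,8) by (simp add: feasible_def)
  from complementary_imp_optimal[OF _ adj this] show "optimal_solution A B T G P0T Y Q YT"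
    using comp neg \<open>0 < T\<close> \<open>YT = Y T\<close> by simp
qed

end
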